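(* Let $\mathcal{S}$ be a multiset of nine integers containing at least one zero. Then $\mathcal{S}$ is $\mathrm{PSI}_3$ if and only if either $\mathcal{S}$ has at most one nonzero element, or $$\mathcal{S}=\{a,b,0^{[7]}\},\qquad a,b\neq 0,\qquad ab=q^2 \text{ for some } q\in\mathbb{Z}.$$ In particular, no $\mathrm{PSI}_3$ multiset $\mathcal{S}$ has $3\le\nu(\mathcal{S})\le 8$.
   Context: For a multiset $\mathcal{S}$ of $n^2$ integers, $\mathcal{M}_n(\mathcal{S})$ denotes the set of all $n\times n$ integer matrices whose $n^2$ entries, counted with multiplicity, are exactly the elements of $\mathcal{S}$. A matrix has integral spectrum if all its eigenvalues are integers. $\mathcal{S}$ is permutation-spectrally integral in dimension $n$ ($\mathrm{PSI}_n$) if every matrix in $\mathcal{M}_n(\mathcal{S})$ has integral spectrum. The density $\nu(\mathcal{S})$ is the number of nonzero elements of $\mathcal{S}$, counted with multiplicity. The notation $x^{[m]}$ means $m$ copies of $x$. *)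

theory Defs
  imports "Jordan_Normal_Form.Spectral_Radius" "HOL-Library.Multiset"
begin

definition entries_mset :: "'a mat \<Rightarrow> 'a multiset" where
  "entries_mset A = image_mset (\<lambda>ij. A $$ ij) (mset_set ({0..<dim_row A} \<times> {0..<dim_col A}))"

definition matrices_of :: "nat \<Rightarrow> int multiset \<Rightarrow> int mat set" where
  "matrices_of n S = {A \<in> carrier_mat n n. entries_mset A = S}"

text \<open>
  Eigenvalues are taken over the complex numbers: the library's \<open>spectrum\<close> of the integer
  matrix itself would contain only eigenvalues that are already integers. Here \<open>\<int>\<close> is the set
  of integers as a subset of the complex numbers.
\<close>

definition integral_spectrum :: "int mat \<Rightarrow> bool" where
  "integral_spectrum A \<longleftrightarrow> spectrum (map_mat complex_of_int A) \<subseteq> \<int>"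

text \<open>
  The size condition is the standing convention for multisets in dimension \<open>n\<close>; without it, the
  universal quantifier would be vacuous for multisets of any other size.
\<close>

definition PSI :: "nat \<Rightarrow> int multiset \<Rightarrow> bool" where
  "PSI n S \<longleftrightarrow> size S = n\<^sup>2 \<and> (\<forall>A \<in> matrices_of n S. integral_spectrum A)"

definition density :: "int multiset \<Rightarrow> nat" where
  "density S = size (filter_mset (\<lambda>x. x \<noteq> 0) S)"

end

theory Submission
  imports Defs "HOL-Library.Extended_Nat"
begin

text \<open>
  The characteristic polynomial of a \<open>3\<times>3\<close> matrix is \<open>x\<^sup>3 - e1 x\<^sup>2 + e2 x - e3\<close>, where
  \<open>e1\<close>, \<open>e2\<close>, \<open>e3\<close> are the trace, the sum of the principal \<open>2\<times>2\<close> minors and the determinant.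
  The spectrum is integral iff this monic cubic splits over the integers
  (\<open>integral_spectrum_3_iff\<close>).

  The hard direction is to find, for every multiset with a zero and at least three nonzero
  elements, an arrangement whose cubic does not split. A single arrangement works, and the
  obstruction is purely 2-adic. Sort the entries by 2-adic valuation as
  \<open>a, b, c, d, e, f, g, h, 0\<close>, the zeros last, and form the matrix with rows
  \<open>(d, a, g)\<close>, \<open>(0, e, b)\<close>, \<open>(c, h, f)\<close>. The three entries that are least divisible by \<open>2\<close>
  form a 3-cycle, and the zero stands opposite the least divisible one. Dividing all entries by
  a power of \<open>2\<close> makes \<open>a\<close> odd. If at most three entries are odd, then \<open>abc\<close> is the
  unique term of least valuation in the determinant, and the Newton polygon of the cubic is a
  single segment. If its slope is not an integer, then no root is an integer. Otherwise rescaling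
  the roots turns the cubic into \<open>x\<^sup>3 - 1\<close> modulo \<open>2\<close>, which has the irreducible factor
  \<open>x\<^sup>2 + x + 1\<close>, so the cubic cannot split; \<open>newton_polygon_no_split\<close> turns
  this into an argument about the valuations of three integer roots. If four to eight entries are
  odd, the cubic itself already fails to split modulo \<open>2\<close>: the matrix is arranged so that
  this happens for each of the five possible numbers. Both cases are in
  \<open>dyadic_chain_no_split_odd\<close>.

  With at most two nonzero entries, no product of three entries survives. If two nonzero entries
  \<open>a\<close>, \<open>b\<close> face each other across the diagonal, the cubic is \<open>x\<^sup>3 - ab x\<close>, which splits iff
  \<open>ab\<close> is a square; in every other arrangement the eigenvalues are the diagonal entries.
\<close>

section \<open>Monic cubics that split over the integers\<close>

text \<open>
  The arguments are the elementary symmetric functions of the roots, so the cubic in question is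
  \<open>x\<^sup>3 - e1 x\<^sup>2 + e2 x - e3\<close>.
\<close>

definition cubic_splits :: "int \<Rightarrow> int \<Rightarrow> int \<Rightarrow> bool" where
  "cubic_splits e1 e2 e3 \<longleftrightarrow>
     (\<exists>r s t. e1 = r + s + t \<and> e2 = r * s + r * t + s * t \<and> e3 = r * s * t)"

text \<open>
  Modulo \<open>2\<close> the only split cubics are \<open>x\<^sup>3\<close>, \<open>x\<^sup>2(x+1)\<close>, \<open>x(x+1)\<^sup>2\<close> and \<open>(x+1)\<^sup>3\<close>; the other four
  parity patterns contain an irreducible quadratic or cubic.
\<close>

lemma cubic_splits_parity:
  assumes "cubic_splits e1 e2 e3"
  shows "if odd e3 then odd e1 \<and> odd e2 else even e1 \<or> even e2"
proof -
  from assms obtain r s t where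
    "e1 = r + s + t" "e2 = r * s + r * t + s * t" "e3 = r * s * t"
    unfolding cubic_splits_def by blast
  then show ?thesis by auto
qed

text \<open>
  Modulo \<open>2\<close> the cubic in the assumption is \<open>x\<^sup>3\<close>, so all three roots are even. This is why a
  common power of \<open>2\<close> can be removed from the entries of a matrix without leaving the integers.
\<close>

lemma cubic_splits_half:
  assumes "cubic_splits (2 * e1) (4 * e2) (8 * e3)"
  shows "cubic_splits e1 e2 e3"
proof -
  from assms obtain r s t where
    1: "2 * e1 = r + s + t" and 2: "4 * e2 = r * s + r * t + s * t" and 3: "8 * e3 = r * s * t"
    unfolding cubic_splits_def by blast
  have "even (r * s * t)" using 3[symmetric] by simp
  moreover have "even (r + s + t)" using 1[symmetric] by simp
  moreover have "even (r * s + r * t + s * t)" using 2[symmetric] by simp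
  ultimately have "even r \<and> even s \<and> even t" by auto
  then obtain r' s' t' where "r = 2 * r'" "s = 2 * s'" "t = 2 * t'" by (auto elim!: evenE)
  with 1 2 3 have "e1 = r' + s' + t'" "e2 = r' * s' + r' * t' + s' * t'" "e3 = r' * s' * t'"
    by auto
  then show ?thesis unfolding cubic_splits_def by blast
qed

lemma cubic_splits_unscale:
  assumes "cubic_splits (2 ^ n * e1) ((2 ^ n)\<^sup>2 * e2) ((2 ^ n) ^ 3 * e3)"
  shows "cubic_splits e1 e2 e3"
  using assms
proof (induction n)
  case 0
  then show ?case by simp
next
  case (Suc n)
  have "cubic_splits (2 * (2 ^ n * e1)) (4 * ((2 ^ n)\<^sup>2 * e2)) (8 * ((2 ^ n) ^ 3 * e3))"
    using Suc.prems by (simp add: power_mult_distrib mult.assoc)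
  then show ?case using cubic_splits_half Suc.IH by blast
qed

section \<open>The 2-adic obstruction\<close>

lemma odd_times_power2_dvd:
  fixes u :: int
  assumes "2 ^ k dvd 2 ^ l * u" "odd u"
  shows "k \<le> l"
proof -
  have "coprime (2 ^ k) u" using assms(2) by simp
  with assms(1) have "(2::int) ^ k dvd 2 ^ l" by (simp add: coprime_dvd_mult_left_iff)
  then have "(2::int) ^ k \<le> 2 ^ l" by (rule zdvd_imp_le) simp
  then show ?thesis by simp
qed

lemma odd_times_power2_eq:
  fixes u v :: int
  assumes "2 ^ k * u = 2 ^ l * v" "odd u" "odd v"
  shows "k = l"
  using odd_times_power2_dvd[of k l v] odd_times_power2_dvd[of l k u] assms
  by (metis dvd_triv_left le_antisym)

lemma int_two_adic_decomp:
  fixes r :: int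
  assumes "r \<noteq> 0"
  obtains k u where "r = 2 ^ k * u" "odd u"
  using assms by (rule multiplicity_decompose'[where p = 2]) (auto intro: that)

text \<open>
  The hypotheses say that the Newton polygon at \<open>2\<close> is one segment, of slope \<open>(p + q) / 3\<close> up to
  sign, with the points of \<open>e1\<close> and \<open>e2\<close> strictly above it. All roots would then have the same
  valuation \<open>i\<close>, with \<open>3 i = p + q\<close>, and their sum, being \<open>2 ^ i\<close> times a sum of three odd
  numbers, would have valuation \<open>i < Q\<close>, against \<open>2 ^ Q dvd e1\<close>.
\<close>

lemma newton_polygon_no_split:
  assumes split: "cubic_splits e1 e2 e3"
    and e3: "e3 = 2 ^ (p + q) * u" "odd u"
    and e1: "2 ^ Q dvd e1"
    and e2: "2 ^ (p + Q) dvd e2"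
    and pq: "p \<le> q" "q \<le> Q" "1 \<le> Q"
  shows False
proof -
  have main: False
    if s1: "e1 = 2 ^ i * r + 2 ^ j * s + 2 ^ k * t"
      and s2: "e2 = (2 ^ i * r) * (2 ^ j * s) + (2 ^ i * r) * (2 ^ k * t) + (2 ^ j * s) * (2 ^ k * t)"
      and s3: "e3 = (2 ^ i * r) * (2 ^ j * s) * (2 ^ k * t)"
      and o: "odd r" "odd s" "odd t" and ijk: "i \<le> j" "j \<le> k"
    for i j k :: nat and r s t :: int
  proof -
    have "2 ^ (i + j + k) * (r * s * t) = 2 ^ (p + q) * u"
      using s3 e3 by (simp add: power_add mult_ac)
    from odd_times_power2_eq[OF this] o e3(2) have sum: "i + j + k = p + q" by simp
    obtain j' where j': "j = i + j'" using ijk(1) le_Suc_ex by blast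
    obtain k' where k': "k = j + k'" using ijk(2) le_Suc_ex by blast
    have e1': "e1 = 2 ^ i * (r + 2 ^ j' * s + 2 ^ (j' + k') * t)"
      unfolding s1 j' k' by (simp add: power_add algebra_simps)
    show False
    \<comment> \<open>Two roots of equal, strictly smallest valuation are excluded by their product, which
      dominates \<open>e2\<close>. In every other case an odd number of roots has the smallest valuation, so
      this is the valuation of their sum \<open>e1\<close>.\<close>
    proof (cases "j' = 0 \<and> k' \<noteq> 0")
      case True
      have "e2 = 2 ^ (i + i) * (r * s + 2 ^ k' * (r * t + s * t))"
        unfolding s2 j' k' using True by (simp add: power_add algebra_simps)
      with e2 have "2 ^ (p + Q) dvd 2 ^ (i + i) * (r * s + 2 ^ k' * (r * t + s * t))" by simp
      from odd_times_power2_dvd[OF this] have "p + Q \<le> i + i" using o True by simp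
      with sum j' k' True pq show False by linarith
    next
      case False
      then have "odd (r + 2 ^ j' * s + 2 ^ (j' + k') * t)" using o by auto
      with odd_times_power2_dvd e1 e1' have "Q \<le> i" by metis
      with sum pq ijk show False by linarith
    qed
  qed
  from split obtain r s t where
    rst: "e1 = r + s + t" "e2 = r * s + r * t + s * t" "e3 = r * s * t"
    unfolding cubic_splits_def by blast
  have "e3 \<noteq> 0" using e3 by auto
  with rst have "r \<noteq> 0" "s \<noteq> 0" "t \<noteq> 0" by auto
  then obtain i r' j s' k t' where
    d: "r = 2 ^ i * r'" "odd r'" "s = 2 ^ j * s'" "odd s'" "t = 2 ^ k * t'" "odd t'"
    by (metis int_two_adic_decomp)
  consider "i \<le> j \<and> j \<le> k" | "i \<le> k \<and> k \<le> j" | "j \<le> i \<and> i \<le> k" | "j \<le> k \<and> k \<le> i"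
    | "k \<le> i \<and> i \<le> j" | "k \<le> j \<and> j \<le> i" by linarith
  then show False
  proof cases
    case 1 then show ?thesis using main[of i r' j s' k t'] d rst by (simp add: algebra_simps)
  next
    case 2 then show ?thesis using main[of i r' k t' j s'] d rst by (simp add: algebra_simps)
  next
    case 3 then show ?thesis using main[of j s' i r' k t'] d rst by (simp add: algebra_simps)
  next
    case 4 then show ?thesis using main[of j s' k t' i r'] d rst by (simp add: algebra_simps)
  next
    case 5 then show ?thesis using main[of k t' i r' j s'] d rst by (simp add: algebra_simps)
  next
    case 6 then show ?thesis using main[of k t' j s' i r'] d rst by (simp add: algebra_simps)
  qed
qed

text \<open>
  Comparison of 2-adic valuations, with valuation \<open>\<infinity>\<close> for zero. Quantifying over the powers of
  \<open>2\<close> avoids \<open>multiplicity 2 0\<close>, whose value is \<open>0\<close>.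
\<close>

definition dyadic_le :: "int \<Rightarrow> int \<Rightarrow> bool" where
  "dyadic_le x y \<longleftrightarrow> (\<forall>k. 2 ^ k dvd x \<longrightarrow> 2 ^ k dvd y)"

lemma dyadic_leD: "dyadic_le x y \<Longrightarrow> 2 ^ k dvd x \<Longrightarrow> 2 ^ k dvd y"
  unfolding dyadic_le_def by blast

lemma dyadic_le_even: "dyadic_le x y \<Longrightarrow> even x \<Longrightarrow> even y"
  using dyadic_leD[of x y 1] by simp

lemma dyadic_le_cancel:
  assumes "dyadic_le (2 ^ n * x) (2 ^ n * y)"
  shows "dyadic_le x y"
  unfolding dyadic_le_def
proof (intro allI impI)
  fix k assume "2 ^ k dvd x"
  then have "2 ^ (n + k) dvd 2 ^ n * x" by (simp add: power_add)
  with assms have "2 ^ (n + k) dvd 2 ^ n * y" by (rule dyadic_leD)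
  then show "2 ^ k dvd y" by (simp add: power_add)
qed

text \<open>
  The three numbers are \<open>e1\<close>, \<open>e2\<close>, \<open>e3\<close> of the matrix with rows \<open>(d, a, g)\<close>, \<open>(0, e, b)\<close>,
  \<open>(c, h, f)\<close>. Since the odd entries come first in the chain, \<open>d\<close> is odd iff at least four entries
  are odd. Then \<open>a\<close>, \<open>b\<close>, \<open>c\<close> are odd as well, and the cubic modulo \<open>2\<close> depends only on how many of
  \<open>e\<close>, \<open>f\<close>, \<open>g\<close>, \<open>h\<close> are odd: for \<open>0, 1, 2, 3, 4\<close> of them, the parities of
  \<open>(e1, e2, e3)\<close> are \<open>(1,0,1)\<close>, \<open>(0,1,1)\<close>, \<open>(1,1,0)\<close>, \<open>(1,0,1)\<close>, \<open>(1,1,0)\<close>, all of them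
  impossible for a split cubic. If \<open>d\<close> is even, the Newton polygon decides.
\<close>

lemma dyadic_chain_no_split_odd:
  fixes a b c d e f g h :: int
  assumes chain: "dyadic_le a b" "dyadic_le b c" "dyadic_le c d" "dyadic_le d e"
      "dyadic_le e f" "dyadic_le f g" "dyadic_le g h"
    and a: "odd a" and c: "c \<noteq> 0"
  shows "\<not> cubic_splits (d + e + f) (d * e + d * f + e * f - c * g - b * h)
           (d * e * f + a * b * c - d * b * h - e * c * g)"
    (is "\<not> cubic_splits ?e1 ?e2 ?e3")
proof
  assume split: "cubic_splits ?e1 ?e2 ?e3"
  show False
  proof (cases "odd d")
    case True
    have "odd b" "odd c" using True chain dyadic_le_even by blast+
    moreover have "even e \<Longrightarrow> even f" "even f \<Longrightarrow> even g" "even g \<Longrightarrow> even h"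
      using chain dyadic_le_even by blast+
    ultimately show False using cubic_splits_parity[OF split] a True
      by (auto split: if_splits)
  next
    case False
    have "b \<noteq> 0"
    proof
      assume "b = 0"
      then have "\<forall>k. 2 ^ k dvd c" using chain(2) by (simp add: dyadic_le_def)
      then show False
        using c by (metis int_two_adic_decomp odd_times_power2_dvd Suc_n_not_le_n)
    qed
    then obtain p b' where b': "b = 2 ^ p * b'" "odd b'" by (rule int_two_adic_decomp)
    obtain q c' where c': "c = 2 ^ q * c'" "odd c'" using c by (rule int_two_adic_decomp)
    have pq: "p \<le> q"
      using dyadic_leD[OF chain(2), of p] b' c' odd_times_power2_dvd[of p q c'] by simp
    \<comment> \<open>\<open>Q\<close> bounds the valuations of \<open>d\<close> to \<open>h\<close> from below; the maximum with \<open>1\<close> matters when \<open>c\<close>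
      is odd, where only the evenness of \<open>d\<close> separates the later entries from \<open>a\<close>, \<open>b\<close>, \<open>c\<close>.\<close>
    define Q where "Q = max 1 q"
    have Q: "q \<le> Q" "1 \<le> Q" by (auto simp: Q_def)
    have dQ: "2 ^ Q dvd d"
      using dyadic_leD[OF chain(3), of q] c' False by (auto simp: Q_def max_def)
    then have eQ: "2 ^ Q dvd e" using dyadic_leD chain by blast
    then have fQ: "2 ^ Q dvd f" using dyadic_leD chain by blast
    then have gQ: "2 ^ Q dvd g" using dyadic_leD chain by blast
    then have hQ: "2 ^ Q dvd h" using dyadic_leD chain by blast
    from dQ eQ fQ gQ hQ obtain d' e' f' g' h' where
      z: "d = 2 ^ Q * d'" "e = 2 ^ Q * e'" "f = 2 ^ Q * f'" "g = 2 ^ Q * g'" "h = 2 ^ Q * h'"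
      unfolding dvd_def by blast
    have le1: "(2::int) ^ (p + Q) dvd 2 ^ (Q + Q)" "(2::int) ^ (p + Q) dvd 2 ^ (q + Q)"
      using pq Q by (auto intro!: le_imp_power_dvd)
    have e2: "2 ^ (p + Q) dvd ?e2"
    proof -
      have "?e2 = 2 ^ (Q + Q) * (d' * e' + d' * f' + e' * f')
                  - 2 ^ (q + Q) * (c' * g') - 2 ^ (p + Q) * (b' * h')"
        unfolding z b' c' by (simp add: power_add algebra_simps)
      then show ?thesis using le1 by (simp add: dvd_diff dvd_mult2)
    qed
    have le2: "(2::int) ^ (p + q + 1) dvd 2 ^ (Q + Q + Q)"
        "(2::int) ^ (p + q + 1) dvd 2 ^ (Q + p + Q)" "(2::int) ^ (p + q + 1) dvd 2 ^ (Q + q + Q)"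
      by (rule le_imp_power_dvd; use pq Q in linarith)+
    have "(2::int) ^ (p + q + 1) dvd d * e * f - d * b * h - e * c * g"
    proof -
      have "d * e * f - d * b * h - e * c * g = 2 ^ (Q + Q + Q) * (d' * e' * f')
              - 2 ^ (Q + p + Q) * (d' * b' * h') - 2 ^ (Q + q + Q) * (e' * c' * g')"
        unfolding z b' c' by (simp add: power_add algebra_simps)
      then show ?thesis using le2 by (metis dvd_diff dvd_mult2)
    qed
    then obtain w where "d * e * f - d * b * h - e * c * g = 2 ^ (p + q + 1) * w" by (rule dvdE)
    then have e3: "?e3 = 2 ^ (p + q) * (a * b' * c' + 2 * w)"
      unfolding b' c' by (simp add: power_add algebra_simps)
    show False
      by (rule newton_polygon_no_split[OF split e3 _ _ e2 pq Q])
        (use a b' c' dQ eQ fQ in auto)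
  qed
qed

lemma dyadic_chain_no_split:
  fixes a b c d e f g h :: int
  assumes chain: "dyadic_le a b" "dyadic_le b c" "dyadic_le c d" "dyadic_le d e"
      "dyadic_le e f" "dyadic_le f g" "dyadic_le g h"
    and nz: "a \<noteq> 0" "c \<noteq> 0"
  shows "\<not> cubic_splits (d + e + f) (d * e + d * f + e * f - c * g - b * h)
           (d * e * f + a * b * c - d * b * h - e * c * g)"
proof
  assume split: "cubic_splits (d + e + f) (d * e + d * f + e * f - c * g - b * h)
           (d * e * f + a * b * c - d * b * h - e * c * g)"
  obtain n a' where a': "a = 2 ^ n * a'" "odd a'" using nz(1) by (rule int_two_adic_decomp)
  have "2 ^ n dvd a" using a' by simp
  moreover from this have "2 ^ n dvd b" using dyadic_leD chain by blast
  moreover from this have "2 ^ n dvd c" using dyadic_leD chain by blast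
  moreover from this have "2 ^ n dvd d" using dyadic_leD chain by blast
  moreover from this have "2 ^ n dvd e" using dyadic_leD chain by blast
  moreover from this have "2 ^ n dvd f" using dyadic_leD chain by blast
  moreover from this have "2 ^ n dvd g" using dyadic_leD chain by blast
  moreover from this have "2 ^ n dvd h" using dyadic_leD chain by blast
  ultimately obtain b' c' d' e' f' g' h' where
    z: "b = 2 ^ n * b'" "c = 2 ^ n * c'" "d = 2 ^ n * d'" "e = 2 ^ n * e'" "f = 2 ^ n * f'"
      "g = 2 ^ n * g'" "h = 2 ^ n * h'"
    unfolding dvd_def by blast
  have "d + e + f = 2 ^ n * (d' + e' + f')"
    unfolding z by (simp add: algebra_simps)
  moreover have "d * e + d * f + e * f - c * g - b * h =
      (2 ^ n)\<^sup>2 * (d' * e' + d' * f' + e' * f' - c' * g' - b' * h')"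
    unfolding z by (simp add: algebra_simps power2_eq_square)
  moreover have "d * e * f + a * b * c - d * b * h - e * c * g =
      (2 ^ n) ^ 3 * (d' * e' * f' + a' * b' * c' - d' * b' * h' - e' * c' * g')"
    unfolding z a' by (simp add: algebra_simps power3_eq_cube)
  ultimately have "cubic_splits (d' + e' + f') (d' * e' + d' * f' + e' * f' - c' * g' - b' * h')
      (d' * e' * f' + a' * b' * c' - d' * b' * h' - e' * c' * g')"
    using split cubic_splits_unscale by metis
  moreover have "c' \<noteq> 0" using nz z by auto
  ultimately show False
    using dyadic_chain_no_split_odd[of a' b' c' d' e' f' g' h'] chain[unfolded z a'] a'(2)
    by (blast dest: dyadic_le_cancel)
qed

section \<open>Integral spectrum of three-dimensional matrices\<close>

lemma det_3:
  fixes A :: "'a :: comm_ring_1 mat"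
  assumes "A \<in> carrier_mat 3 3"
  shows "det A =
      A $$ (0,0) * (A $$ (1,1) * A $$ (2,2) - A $$ (1,2) * A $$ (2,1))
    - A $$ (0,1) * (A $$ (1,0) * A $$ (2,2) - A $$ (1,2) * A $$ (2,0))
    + A $$ (0,2) * (A $$ (1,0) * A $$ (2,1) - A $$ (1,1) * A $$ (2,0))"
proof -
  have det2: "det B = B $$ (0,0) * B $$ (1,1) - B $$ (0,1) * B $$ (1,0)"
    if "B \<in> carrier_mat 2 2" for B :: "'a mat"
    using that by (subst laplace_expansion_row[of B 2 0])
      (auto simp: cofactor_def mat_delete_def det_single numeral_2_eq_2 algebra_simps)
  have minor: "mat_delete A 0 j \<in> carrier_mat 2 2" for j
    using assms by (auto simp: mat_delete_def)
  show ?thesis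
    using assms minor
    by (subst laplace_expansion_row[of A 3 0])
      (auto simp: cofactor_def det2 numeral_3_eq_3 lessThan_Suc mat_delete_def algebra_simps
         numeral_2_eq_2)
qed


definition principal_minors :: "'a :: comm_ring_1 mat \<Rightarrow> 'a" where
  "principal_minors A =
       (A $$ (0,0) * A $$ (1,1) - A $$ (0,1) * A $$ (1,0))
     + (A $$ (0,0) * A $$ (2,2) - A $$ (0,2) * A $$ (2,0))
     + (A $$ (1,1) * A $$ (2,2) - A $$ (1,2) * A $$ (2,1))"

lemma char_poly_3:
  fixes A :: "'a :: comm_ring_1 mat"
  assumes A: "A \<in> carrier_mat 3 3"
  shows "char_poly A =
    [:- det A, principal_minors A, - (A $$ (0,0) + A $$ (1,1) + A $$ (2,2)), 1:]"
proof -
  have "char_poly_matrix A \<in> carrier_mat 3 3"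
    using A by (auto simp: char_poly_matrix_def)
  then show ?thesis
    unfolding char_poly_def
    using A by (subst det_3)
      (auto simp: char_poly_matrix_def det_3[OF A] principal_minors_def algebra_simps)
qed

text \<open>
  Integrality of all eigenvalues refers to the set of roots, splitting to roots with
  multiplicity. The two agree because the characteristic polynomial is a product of linear factors
  over the complex numbers, and each root in that product is an eigenvalue.
\<close>

lemma integral_spectrum_3_iff:
  assumes A: "A \<in> carrier_mat 3 3"
  shows "integral_spectrum A \<longleftrightarrow>
    cubic_splits (A $$ (0,0) + A $$ (1,1) + A $$ (2,2)) (principal_minors A) (det A)"
proof -
  let ?C = "map_mat complex_of_int A"
  let ?e1 = "A $$ (0,0) + A $$ (1,1) + A $$ (2,2)"
  have C: "?C \<in> carrier_mat 3 3" using A by simp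
  have cp: "char_poly ?C =
      [:- of_int (det A), of_int (principal_minors A), - of_int ?e1, 1:]"
    unfolding char_poly_3[OF C] det_3[OF C] det_3[OF A] principal_minors_def
    using A by simp
  have spec: "z \<in> spectrum ?C \<longleftrightarrow> poly (char_poly ?C) z = 0" for z
    using eigenvalue_root_char_poly[OF C] by (simp add: spectrum_def)
  show ?thesis
  proof
    assume int: "integral_spectrum A"
    obtain as where as: "char_poly ?C = (\<Prod>a\<leftarrow>as. [:- a, 1:])" "length as = 3"
      using char_poly_factorized[OF C] by blast
    then obtain x y z where xyz: "as = [x, y, z]"
      by (auto simp: numeral_3_eq_3 length_Suc_conv)
    have root: "poly (char_poly ?C) w = (w - x) * (w - y) * (w - z)" for w
      unfolding as xyz by (simp add: algebra_simps)
    have "x \<in> spectrum ?C" "y \<in> spectrum ?C" "z \<in> spectrum ?C"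
      unfolding spec root by simp_all
    with int have "x \<in> \<int>" "y \<in> \<int>" "z \<in> \<int>" unfolding integral_spectrum_def by auto
    then obtain r s t where rst: "x = of_int r" "y = of_int s" "z = of_int t"
      by (auto elim!: Ints_cases)
    have "char_poly ?C = [:- (x * y * z), x * y + x * z + y * z, - (x + y + z), 1:]"
      unfolding poly_eq_poly_eq_iff[symmetric]
      by (rule ext) (simp add: root algebra_simps)
    then have "of_int ?e1 = complex_of_int (r + s + t)"
        "of_int (principal_minors A) = complex_of_int (r * s + r * t + s * t)"
        "of_int (det A) = complex_of_int (r * s * t)"
      unfolding cp rst
      by (simp_all only: pCons_eq_iff neg_equal_iff_equal of_int_add of_int_mult)
    then show "cubic_splits ?e1 (principal_minors A) (det A)"
      unfolding cubic_splits_def of_int_eq_iff by blast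
  next
    assume "cubic_splits ?e1 (principal_minors A) (det A)"
    then obtain r s t where
      rst: "?e1 = r + s + t" "principal_minors A = r * s + r * t + s * t" "det A = r * s * t"
      unfolding cubic_splits_def by blast
    have "poly (char_poly ?C) z = (z - of_int r) * (z - of_int s) * (z - of_int t)" for z
      unfolding cp rst by (simp add: algebra_simps)
    then show "integral_spectrum A"
      unfolding integral_spectrum_def by (auto simp: spec)
  qed
qed

lemma entries_mset_3:
  assumes "A \<in> carrier_mat 3 3"
  shows "entries_mset A =
    {#A $$ (0,0), A $$ (0,1), A $$ (0,2),
      A $$ (1,0), A $$ (1,1), A $$ (1,2),
      A $$ (2,0), A $$ (2,1), A $$ (2,2)#}"
proof -
  have "{0..<3} \<times> {0..<3} =
      {(0,0), (0,1), (0,2), (1,0), (1,1), (1,2), (2,0), (2,1), (2,2)::nat \<times> nat}"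
    by (auto simp: numeral_3_eq_3 numeral_2_eq_2 less_Suc_eq)
  then show ?thesis
    using assms by (simp add: entries_mset_def)
qed

text \<open>
  Arrangements of a multiset become equations between multisets of nine variables, so that all
  later arguments can choose entries freely and need no matrices.
\<close>

lemma PSI_3_iff:
  "PSI 3 S \<longleftrightarrow> size S = 9 \<and>
     (\<forall>a11 a12 a13 a21 a22 a23 a31 a32 a33.
        S = {#a11, a12, a13, a21, a22, a23, a31, a32, a33#} \<longrightarrow>
        cubic_splits (a11 + a22 + a33)
          ((a11 * a22 - a12 * a21) + (a11 * a33 - a13 * a31) + (a22 * a33 - a23 * a32))
          (a11 * (a22 * a33 - a23 * a32) - a12 * (a21 * a33 - a23 * a31)
             + a13 * (a21 * a32 - a22 * a31)))"
    (is "_ \<longleftrightarrow> _ \<and> ?entries")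
proof -
  have "(\<forall>A \<in> matrices_of 3 S. integral_spectrum A) \<longleftrightarrow> ?entries"
  proof (intro iffI allI impI ballI)
    fix a11 a12 a13 a21 a22 a23 a31 a32 a33
    assume int: "\<forall>A \<in> matrices_of 3 S. integral_spectrum A"
      and S: "S = {#a11, a12, a13, a21, a22, a23, a31, a32, a33#}"
    let ?A = "mat_of_rows_list 3 [[a11, a12, a13], [a21, a22, a23], [a31, a32, a33]]"
    have A: "?A \<in> carrier_mat 3 3" by (rule carrier_matI) (simp_all add: mat_of_rows_list_def)
    have "?A \<in> matrices_of 3 S"
      using A entries_mset_3[OF A] by (simp add: matrices_of_def S mat_of_rows_list_def)
    with int have "integral_spectrum ?A" by blast
    then show "cubic_splits (a11 + a22 + a33)
          ((a11 * a22 - a12 * a21) + (a11 * a33 - a13 * a31) + (a22 * a33 - a23 * a32))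
          (a11 * (a22 * a33 - a23 * a32) - a12 * (a21 * a33 - a23 * a31)
             + a13 * (a21 * a32 - a22 * a31))"
      unfolding integral_spectrum_3_iff[OF A] det_3[OF A] principal_minors_def
      by (simp add: mat_of_rows_list_def)
  next
    fix A assume ent: ?entries and "A \<in> matrices_of 3 S"
    then have A: "A \<in> carrier_mat 3 3" and S: "S = entries_mset A"
      by (auto simp: matrices_of_def)
    show "integral_spectrum A"
      unfolding integral_spectrum_3_iff[OF A] det_3[OF A] principal_minors_def
      by (rule ent[rule_format]) (unfold S, rule entries_mset_3[OF A])
  qed
  then show ?thesis by (simp add: PSI_def)
qed

section \<open>At least three nonzero elements\<close>

lemma dyadic_sorting:
  fixes S :: "int multiset"
  assumes "size S = 9" "0 \<in># S" "density S \<ge> 3"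
  obtains a b c d e f g h where "S = {#a, b, c, d, e, f, g, h, 0#}"
    "dyadic_le a b" "dyadic_le b c" "dyadic_le c d" "dyadic_le d e"
    "dyadic_le e f" "dyadic_le f g" "dyadic_le g h" "a \<noteq> 0" "c \<noteq> 0"
proof -
  define v :: "int \<Rightarrow> enat" where "v x = (if x = 0 then \<infinity> else enat (multiplicity 2 x))" for x
  have v_inf: "v x = \<infinity> \<longleftrightarrow> x = 0" for x by (simp add: v_def)
  have v_le: "dyadic_le x y" if "v x \<le> v y" for x y
    using that unfolding dyadic_le_def v_def
    by (auto simp: power_dvd_iff_le_multiplicity split: if_splits)
  obtain ys where ys: "mset ys = S" using ex_mset by blast
  define xs where "xs = sort_key v ys"
  have xs: "mset xs = S" "sorted (map v xs)" using ys by (simp_all add: xs_def)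
  have "length xs = Suc (Suc (Suc (Suc (Suc (Suc (Suc (Suc (Suc 0))))))))"
    using assms(1) by (simp flip: xs(1))
  then obtain a b c d e f g h i where abc: "xs = [a, b, c, d, e, f, g, h, i]"
    by (auto simp: length_Suc_conv)
  have chain: "v a \<le> v b" "v b \<le> v c" "v c \<le> v d" "v d \<le> v e" "v e \<le> v f" "v f \<le> v g"
      "v g \<le> v h" "v h \<le> v i"
    using xs(2) by (auto simp: abc)
  have zero_up: "y = 0" if "v x \<le> v y" "x = 0" for x y
    using that v_inf[of x] v_inf[of y] by simp
  have S: "S = {#a, b, c, d, e, f, g, h, i#}" using xs(1) by (simp add: abc)
  have i: "i = 0"
  proof -
    have "0 \<in> {a, b, c, d, e, f, g, h, i}" using assms(2) by (auto simp: S)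
    moreover have "v x \<le> v i" if "x \<in> {a, b, c, d, e, f, g, h, i}" for x
      using xs(2) that by (auto simp: abc)
    ultimately show ?thesis using zero_up by blast
  qed
  have c: "c \<noteq> 0"
  proof
    assume "c = 0"
    then have "d = 0" "e = 0" "f = 0" "g = 0" "h = 0" using chain zero_up by blast+
    then have "density S \<le> 2" using \<open>c = 0\<close> i by (simp add: density_def S)
    with assms(3) show False by simp
  qed
  then have "a \<noteq> 0" using chain zero_up by blast
  with that[of a b c d e f g h] show thesis using S i c chain v_le by simp
qed

lemma PSI_3_density_le_2:
  assumes psi: "PSI 3 S" and zero: "0 \<in># S"
  shows "density S \<le> 2"
proof (rule ccontr)
  assume "\<not> density S \<le> 2"
  then have "density S \<ge> 3" by simp
  moreover have "size S = 9" using psi by (simp add: PSI_3_iff)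
  ultimately obtain a b c d e f g h where S: "S = {#a, b, c, d, e, f, g, h, 0#}" and
    chain: "dyadic_le a b" "dyadic_le b c" "dyadic_le c d" "dyadic_le d e"
    "dyadic_le e f" "dyadic_le f g" "dyadic_le g h" and nz: "a \<noteq> 0" "c \<noteq> 0"
    using zero dyadic_sorting by metis
  have "S = {#d, a, g, 0, e, b, c, h, f#}" unfolding S by (simp add: add_mset_commute)
  with psi have "cubic_splits (d + e + f)
      ((d * e - a * 0) + (d * f - g * c) + (e * f - b * h))
      (d * (e * f - b * h) - a * (0 * f - b * c) + g * (0 * h - e * c))"
    unfolding PSI_3_iff by blast
  then have "cubic_splits (d + e + f) (d * e + d * f + e * f - c * g - b * h)
           (d * e * f + a * b * c - d * b * h - e * c * g)"
    by (simp add: algebra_simps)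
  with dyadic_chain_no_split[OF chain nz] show False by blast
qed

section \<open>At most two nonzero elements\<close>

lemma density_2_form:
  assumes "size S = 9" "density S = 2"
  obtains a b where "S = {#a, b#} + replicate_mset 7 0" "a \<noteq> 0" "b \<noteq> 0"
proof -
  let ?N = "filter_mset (\<lambda>x. x \<noteq> 0) S"
  have split: "S = ?N + filter_mset (\<lambda>x. x = 0) S"
    using multiset_partition[of S "\<lambda>x. x \<noteq> 0"] by simp
  have "size ?N = 2" using assms(2) by (simp add: density_def)
  then obtain a N' where "?N = add_mset a N'"
    using size_eq_Suc_imp_eq_union[of ?N 1] by auto
  moreover from this \<open>size ?N = 2\<close> have "size N' = 1" by simp
  ultimately obtain b where ab: "?N = {#a, b#}" using size_1_singleton_mset by fastforce
  have "size (filter_mset (\<lambda>x. x = 0) S) = 7"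
    using arg_cong[OF split, of size] assms(1) by (simp add: ab)
  then have "filter_mset (\<lambda>x. x = 0) S = replicate_mset 7 0"
    by (metis filter_eq_replicate_mset size_replicate_mset)
  then have "S = {#a, b#} + replicate_mset 7 0" using split unfolding ab by argo
  moreover have "\<forall>x \<in># ?N. x \<noteq> 0" by simp
  then have "a \<noteq> 0" "b \<noteq> 0" unfolding ab by simp_all
  ultimately show thesis using that by blast
qed

lemma PSI_3_pair_square:
  assumes "PSI 3 ({#a, b#} + replicate_mset 7 0)"
  shows "\<exists>q. a * b = q\<^sup>2"
proof -
  \<comment> \<open>Placing \<open>a\<close> and \<open>b\<close> opposite each other gives the cubic \<open>x\<^sup>3 - ab x\<close>.\<close>
  have "{#a, b#} + replicate_mset 7 0 = {#0, a, 0, b, 0, 0, 0, 0, 0::int#}"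
    by (simp add: numeral_eq_Suc add_mset_commute)
  with assms have "cubic_splits (0 + 0 + 0)
      ((0 * 0 - a * b) + (0 * 0 - 0 * 0) + (0 * 0 - 0 * 0))
      (0 * (0 * 0 - 0 * 0) - a * (b * 0 - 0 * 0) + 0 * (b * 0 - 0 * 0))"
    unfolding PSI_3_iff by blast
  then obtain r s t where
    "r + s + t = 0" "- (a * b) = r * s + r * t + s * t" "r * s * t = 0"
    unfolding cubic_splits_def by auto
  then have "a * b = - (r * s + r * t + s * t)" "r = 0 \<and> t = - s \<or> s = 0 \<and> t = - r \<or> t = 0 \<and> s = - r"
    by auto
  then have "a * b = s\<^sup>2 \<or> a * b = r\<^sup>2"
    by (auto simp: power2_eq_square)
  then show ?thesis by blast
qed

text \<open>
  Products along 3-cycles vanish, so the off-diagonal entries enter the cubic only through products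
  of opposite pairs. If one such product is nonzero, it is a square \<open>q\<^sup>2\<close>, all other entries
  vanish and the roots are \<open>q\<close>, \<open>-q\<close>, \<open>0\<close>; otherwise the roots are the diagonal entries.
\<close>

lemma PSI_3_density_le_2_square:
  assumes size: "size S = 9" and dens: "density S \<le> 2"
    and square: "density S = 2 \<Longrightarrow> \<exists>q. prod_mset (filter_mset (\<lambda>x. x \<noteq> 0) S) = q\<^sup>2"
  shows "PSI 3 S"
  unfolding PSI_3_iff
proof (intro conjI allI impI)
  fix a11 a12 a13 a21 a22 a23 a31 a32 a33
  assume S: "S = {#a11, a12, a13, a21, a22, a23, a31, a32, a33#}"
  let ?e2 = "(a11 * a22 - a12 * a21) + (a11 * a33 - a13 * a31) + (a22 * a33 - a23 * a32)"
  let ?e3 = "a11 * (a22 * a33 - a23 * a32) - a12 * (a21 * a33 - a23 * a31)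
             + a13 * (a21 * a32 - a22 * a31)"
  \<comment> \<open>Two nonzero factors exhaust the nonzero elements of \<open>S\<close>.\<close>
  have opposite: "\<exists>q. x * y = q\<^sup>2 \<and> (\<forall>z \<in># R. z = 0)"
    if "S = {#x, y#} + R" "x * y \<noteq> 0" for x y R
  proof -
    let ?F = "filter_mset (\<lambda>x. x \<noteq> 0)"
    have F: "?F S = {#x, y#} + ?F R" using that by simp
    then have "size (?F R) = 0" and d: "density S = 2" using dens by (auto simp: density_def)
    then have R: "?F R = {#}" by simp
    obtain q where "x * y = q\<^sup>2" using square[OF d] F R by auto
    moreover have "\<forall>z \<in># R. z = 0" using R by (simp)
    ultimately show ?thesis by blast
  qed
  have triple: "x * y * z = 0" if "S = {#x, y, z#} + R" for x y z R
    using dens that by (auto simp: density_def split: if_splits)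
  consider "a12 * a21 \<noteq> 0" | "a13 * a31 \<noteq> 0" | "a23 * a32 \<noteq> 0"
    | "a12 * a21 = 0" "a13 * a31 = 0" "a23 * a32 = 0" by blast
  then show "cubic_splits (a11 + a22 + a33) ?e2 ?e3"
  proof cases
    case 1
    with opposite[of a12 a21 "{#a11, a13, a22, a23, a31, a32, a33#}"]
    obtain q where "a12 * a21 = q\<^sup>2"
        "a11 = 0" "a13 = 0" "a22 = 0" "a23 = 0" "a31 = 0" "a32 = 0" "a33 = 0"
      unfolding S by auto
    then show ?thesis unfolding cubic_splits_def
      by (intro exI[of _ q] exI[of _ "-q"] exI[of _ 0]) (simp add: power2_eq_square)
  next
    case 2
    with opposite[of a13 a31 "{#a11, a12, a21, a22, a23, a32, a33#}"]
    obtain q where "a13 * a31 = q\<^sup>2"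
        "a11 = 0" "a12 = 0" "a21 = 0" "a22 = 0" "a23 = 0" "a32 = 0" "a33 = 0"
      unfolding S by (auto simp: add_mset_commute)
    then show ?thesis unfolding cubic_splits_def
      by (intro exI[of _ q] exI[of _ "-q"] exI[of _ 0]) (simp add: power2_eq_square)
  next
    case 3
    with opposite[of a23 a32 "{#a11, a12, a13, a21, a22, a31, a33#}"]
    obtain q where "a23 * a32 = q\<^sup>2"
        "a11 = 0" "a12 = 0" "a13 = 0" "a21 = 0" "a22 = 0" "a31 = 0" "a33 = 0"
      unfolding S by (auto simp: add_mset_commute)
    then show ?thesis unfolding cubic_splits_def
      by (intro exI[of _ q] exI[of _ "-q"] exI[of _ 0]) (simp add: power2_eq_square)
  next
    case 4
    have cyc: "a12 * a23 * a31 = 0" "a13 * a21 * a32 = 0"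
      using triple[of a12 a23 a31 "{#a11, a13, a21, a22, a32, a33#}"]
        triple[of a13 a21 a32 "{#a11, a12, a22, a23, a31, a33#}"]
      unfolding S by (simp_all add: add_mset_commute)
    have "?e3 = a11 * a22 * a33 - a11 * (a23 * a32) - a33 * (a12 * a21)
        - a22 * (a13 * a31) + a12 * a23 * a31 + a13 * a21 * a32"
      by (simp add: algebra_simps)
    then have "?e3 = a11 * a22 * a33" unfolding 4 cyc by simp
    moreover have "?e2 = a11 * a22 + a11 * a33 + a22 * a33" unfolding 4 by simp
    ultimately show ?thesis unfolding cubic_splits_def by blast
  qed
qed (fact size)

section \<open>The classification\<close>

theorem theorem3p4:
  shows "(\<forall>S :: int multiset. size S = 9 \<and> 0 \<in># S \<longrightarrow>
            (PSI 3 S \<longleftrightarrow>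
              density S \<le> 1 \<or>
              (\<exists>a b q :: int. S = {#a, b#} + replicate_mset 7 0 \<and>
                 a \<noteq> 0 \<and> b \<noteq> 0 \<and> a * b = q\<^sup>2)))
       \<and> \<not> (\<exists>S :: int multiset. PSI 3 S \<and> 3 \<le> density S \<and> density S \<le> 8)"
proof (intro conjI allI impI notI)
  fix S :: "int multiset"
  assume S: "size S = 9 \<and> 0 \<in># S"
  show "PSI 3 S \<longleftrightarrow> density S \<le> 1 \<or>
      (\<exists>a b q :: int. S = {#a, b#} + replicate_mset 7 0 \<and> a \<noteq> 0 \<and> b \<noteq> 0 \<and> a * b = q\<^sup>2)"
  proof
    assume psi: "PSI 3 S"
    then have "density S \<le> 2" using PSI_3_density_le_2 S by blast
    then consider "density S \<le> 1" | "density S = 2" by linarith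
    then show "density S \<le> 1 \<or>
      (\<exists>a b q :: int. S = {#a, b#} + replicate_mset 7 0 \<and> a \<noteq> 0 \<and> b \<noteq> 0 \<and> a * b = q\<^sup>2)"
    proof cases
      case 2
      with S obtain a b where ab: "S = {#a, b#} + replicate_mset 7 0" "a \<noteq> 0" "b \<noteq> 0"
        using density_2_form by blast
      with psi PSI_3_pair_square show ?thesis by blast
    qed simp
  next
    assume "density S \<le> 1 \<or>
      (\<exists>a b q :: int. S = {#a, b#} + replicate_mset 7 0 \<and> a \<noteq> 0 \<and> b \<noteq> 0 \<and> a * b = q\<^sup>2)"
    then show "PSI 3 S"
    proof (elim disjE exE conjE)
      assume "density S \<le> 1"
      with S show ?thesis by (intro PSI_3_density_le_2_square) auto
    next
      fix a b q :: int
      assume ab: "S = {#a, b#} + replicate_mset 7 0" "a \<noteq> 0" "b \<noteq> 0" "a * b = q\<^sup>2"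
      then have N: "filter_mset (\<lambda>x. x \<noteq> 0) S = {#a, b#}"
        by simp
      have "density S \<le> 2" unfolding density_def N by simp
      moreover have "prod_mset (filter_mset (\<lambda>x. x \<noteq> 0) S) = q\<^sup>2"
        unfolding N using ab(4) by simp
      ultimately show ?thesis using PSI_3_density_le_2_square S by blast
    qed
  qed
next
  assume "\<exists>S :: int multiset. PSI 3 S \<and> 3 \<le> density S \<and> density S \<le> 8"
  then obtain S :: "int multiset" where S: "PSI 3 S" "3 \<le> density S" "density S \<le> 8" by blast
  have "0 \<in># S"
  proof (rule ccontr)
    assume "0 \<notin># S"
    then have "filter_mset (\<lambda>x. x \<noteq> 0) S = S" by (auto simp: filter_mset_eq_conv)
    then have "density S = 9" using S(1) by (simp add: density_def PSI_3_iff)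
    with S(3) show False by simp
  qed
  with S PSI_3_density_le_2[of S] show False by simp
qed

end
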